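(* Let $p_1,p_2\in\mathcal{P}_d(\mathbb{R})$ and $r\in\mathcal{P}_d([0,\infty))$. Then $d_K(p_1\boxtimes_d r,p_2\boxtimes_d r)\le d_K(p_1,p_2)$.
   Context: $\mathcal{P}_d(K)$: monic degree-$d$ polynomials with all roots in $K$. For $p$ with roots $\lambda_i$, $p(x)=\sum_{k=0}^d(-1)^k\binom{d}{k}\tilde e_k(p)x^{d-k}$ with $\tilde e_k(p)=\binom{d}{k}^{-1}e_k(\lambda_1,\dots,\lambda_d)$; $p\boxtimes_d q$ is defined by $\tilde e_k(p\boxtimes_d q)=\tilde e_k(p)\tilde e_k(q)$. $\mu_p=\frac1d\sum_i\delta_{\lambda_i}$ with CDF $\mathcal{F}_p$. Kolmogorov distance: $d_K(p,q)=\inf\{\epsilon>0:|\mathcal{F}_p(x)-\mathcal{F}_q(x)|\le\epsilon\ \forall x\in\mathbb{R}\}$. *)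

theory Defs
  imports "HOL-Computational_Algebra.Polynomial" Complex_Main
begin

definition Pd :: "nat \<Rightarrow> real set \<Rightarrow> real poly set" where
  "Pd d K = {p. lead_coeff p = 1 \<and> degree p = d \<and>
      (\<exists>A. size A = d \<and> set_mset A \<subseteq> K \<and> p = (\<Prod>a\<in>#A. [:-a, 1:]))}"

text \<open>Normalized elementary symmetric polynomial etilde_k(p), read off from the
  expansion p(x) = sum_k (-1)^k (d choose k) etilde_k(p) x^(d-k).\<close>
definition etilde :: "nat \<Rightarrow> real poly \<Rightarrow> nat \<Rightarrow> real" where
  "etilde d p k = (-1) ^ k * coeff p (d - k) / real (d choose k)"

definition mconv :: "nat \<Rightarrow> real poly \<Rightarrow> real poly \<Rightarrow> real poly" where
  "mconv d p q = (\<Sum>k\<le>d. monom ((-1) ^ k * real (d choose k) * etilde d p k * etilde d q k) (d - k))"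

definition rootcdf :: "nat \<Rightarrow> real poly \<Rightarrow> real \<Rightarrow> real" where
  "rootcdf d p x = real (\<Sum>a\<in>{a. poly p a = 0 \<and> a \<le> x}. order a p) / real d"

definition dK :: "nat \<Rightarrow> real poly \<Rightarrow> real poly \<Rightarrow> real" where
  "dK d p q = Inf {e. e > 0 \<and> (\<forall>x. \<bar>rootcdf d p x - rootcdf d q x\<bar> \<le> e)}"

end

theory Submission
  imports Defs "HOL-Computational_Algebra.Fundamental_Theorem_Algebra" "HOL-Real_Asymp.Real_Asymp"
begin

text \<open>Fix r with nonnegative roots. Splitting off one root of r at a time and applying Laguerre's
  theorem on polar derivatives shows that the convolution with r of a polynomial whose roots lie in
  the closed lower half-plane has no zero in the open upper half-plane. In particular real-rootedness
  is preserved. Moreover, replacing a root c of p makes the convolution depend on c as X - c Y, and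
  its nonvanishing for all c in the lower half-plane means Im (X / Y) > 0; hence for real a < b the
  quotient of the convolutions belonging to a and b has negative imaginary part (or equals 1) on the
  upper half-plane. The argument of this quotient therefore stays between -pi and 0, and its
  boundary values count roots: moving a single root of p to the right moves the roots of the
  convolution to the right, each by at most one position. If the root counting functions of two
  polynomials differ by at most k, then moving the k smallest roots of one of them beyond all other
  roots makes it dominate the other one, so the counting functions of the convolutions differ by at
  most k as well.\<close>

section \<open>Monic polynomials given by their multisets of roots\<close>

abbreviation root_poly :: "'a::comm_ring_1 multiset \<Rightarrow> 'a poly" where
  "root_poly A \<equiv> \<Prod>a\<in>#A. [:-a, 1:]"

lemma poly_root_poly: "poly (root_poly A) y = (\<Prod>a\<in>#A. y - a)"
  by (induction A) (simp_all add: algebra_simps)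

lemma poly_root_poly_eq_0_iff:
  fixes A :: "'a::idom multiset"
  shows "poly (root_poly A) y = 0 \<longleftrightarrow> y \<in># A"
  by (auto simp: poly_root_poly)

lemma root_poly_nonzero: "root_poly A \<noteq> (0 :: 'a::idom poly)"
proof -
  have "[:-a, 1:] \<noteq> (0 :: 'a poly)" for a by simp
  then show ?thesis by (metis (no_types, lifting) image_iff prod_mset_zero_iff set_image_mset)
qed

lemma degree_root_poly: "degree (root_poly A :: 'a::idom poly) = size A"
  by (induction A) (auto simp: degree_mult_eq root_poly_nonzero simp del: mult_pCons_left prod_mset_zero_iff)

lemma lead_coeff_root_poly: "lead_coeff (root_poly A :: 'a::idom poly) = 1"
  by (induction A) (simp_all add: lead_coeff_mult del: mult_pCons_left)

lemma coeff_root_poly_size: "coeff (root_poly A :: 'a::idom poly) (size A) = 1"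
  using lead_coeff_root_poly[of A] by (simp add: degree_root_poly)

lemma proots_root_poly: "proots (root_poly A :: 'a::idom poly) = A"
  by (induction A) (auto simp: proots_mult root_poly_nonzero simp del: mult_pCons_left prod_mset_zero_iff)

section \<open>The convolution and its recursion in the roots of one factor\<close>

text \<open>The value at x of the convolution of p and r, indexed by the exponent j = d - k.\<close>
definition conv_val :: "nat \<Rightarrow> complex poly \<Rightarrow> complex poly \<Rightarrow> complex \<Rightarrow> complex" where
  "conv_val d p r x =
    (\<Sum>j\<le>d. (-1) ^ (d - j) * coeff p j * coeff r j / of_nat (d choose j) * x ^ j)"

lemma conv_val_smult: "conv_val d (smult c p) r x = c * conv_val d p r x"
  by (simp add: conv_val_def sum_distrib_left mult_ac)

lemma conv_val_diff: "conv_val d (p - q) r x = conv_val d p r x - conv_val d q r x"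
  by (simp add: conv_val_def sum_subtractf [symmetric] algebra_simps diff_divide_distrib)

text \<open>Up to normalisation, the polar derivative of p with respect to the point x / \<open>\<rho>\<close>, in a
  form that makes sense for \<open>\<rho> = 0\<close>. The evaluation point x of the convolution enters as a parameter.\<close>
definition polar :: "nat \<Rightarrow> complex \<Rightarrow> complex \<Rightarrow> complex poly \<Rightarrow> complex poly" where
  "polar d x \<rho> p = smult \<rho> p + smult (1 / of_nat d) ([:x, -\<rho>:] * pderiv p)"

text \<open>The factor of \<open>coeff p j\<close> vanishes at \<open>j = Suc n\<close>, so applied
  to a polynomial of degree at most \<open>Suc n\<close> the operator yields degree at most
  \<open>n\<close>.\<close>

lemma coeff_polar:
  "coeff (polar (Suc n) x \<rho> p) j = \<rho> * (of_nat (Suc n) - of_nat j) / of_nat (Suc n) * coeff p j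
     + x * of_nat (Suc j) / of_nat (Suc n) * coeff p (Suc j)"
proof -
  have "coeff ([:x, -\<rho>:] * pderiv p) j = x * of_nat (Suc j) * coeff p (Suc j) - \<rho> * of_nat j * coeff p j"
    by (cases j) (simp_all add: coeff_pderiv algebra_simps)
  then have "coeff (polar (Suc n) x \<rho> p) j = \<rho> * coeff p j + 
     1 / of_nat (Suc n) * (x * of_nat (Suc j) * coeff p (Suc j) - \<rho> * of_nat j * coeff p j)"
    unfolding polar_def coeff_add coeff_smult by simp
  moreover have "(of_nat (Suc n) :: complex) \<noteq> 0" using of_nat_eq_0_iff by blast
  ultimately show ?thesis by (simp add: field_simps del: of_nat_Suc)
qed

text \<open>Splits one root \<rho> off the second factor, at the price of a polar derivative of the
  first; this drives the induction on the roots of \<open>r\<close>.\<close>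

lemma conv_val_mult_linear:
  assumes "degree r \<le> n"
  shows "conv_val (Suc n) p ([:-\<rho>, 1:] * r) x = conv_val n (polar (Suc n) x \<rho> p) r x"
proof -
  define c where "c j = (-1) ^ (Suc n - j) * coeff p j / of_nat (Suc n choose j) * x ^ j" for j
  define a where "a j = c j * (case j of 0 \<Rightarrow> 0 | Suc i \<Rightarrow> coeff r i)" for j
  define b where "b j = c j * (\<rho> * coeff r j)" for j
  have "coeff ([:-\<rho>, 1:] * r) j = (case j of 0 \<Rightarrow> 0 | Suc i \<Rightarrow> coeff r i) - \<rho> * coeff r j" for j
    by (cases j) (simp_all add: algebra_simps)
  then have "conv_val (Suc n) p ([:-\<rho>, 1:] * r) x = (\<Sum>j\<le>Suc n. a j - b j)"
    unfolding conv_val_def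
    by (intro sum.cong refl) (simp add: a_def b_def c_def algebra_simps diff_divide_distrib del: mult_pCons_left)
  also have "\<dots> = (\<Sum>j\<le>Suc n. a j) - (\<Sum>j\<le>Suc n. b j)"
    by (rule sum_subtractf)
  \<comment> \<open>The sums \<open>a\<close> and \<open>b\<close> come from \<open>X * r\<close>
    and \<open>\<rho> * r\<close>: the former has no constant term, the latter no term of degree
    \<open>Suc n\<close>, so both shrink to \<open>n + 1\<close> summands.\<close>
  also have "(\<Sum>j\<le>Suc n. a j) = (\<Sum>j\<le>n. a (Suc j))"
    by (subst sum.atMost_Suc_shift) (simp add: a_def)
  also have "(\<Sum>j\<le>Suc n. b j) = (\<Sum>j\<le>n. b j)"
    using assms by (simp add: b_def coeff_eq_0)
  also have "(\<Sum>j\<le>n. a (Suc j)) - (\<Sum>j\<le>n. b j) = (\<Sum>j\<le>n. a (Suc j) - b j)"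
    by (rule sum_subtractf [symmetric])
  also have "\<dots> = conv_val n (polar (Suc n) x \<rho> p) r x"
    unfolding conv_val_def
  proof (rule sum.cong [OF refl])
    fix j assume "j \<in> {..n}"
    then have j: "j \<le> n" by simp
    have nz: "of_nat (n choose j) \<noteq> (0::complex)" "of_nat (Suc n) \<noteq> (0::complex)"
      "of_nat (Suc n choose j) \<noteq> (0::complex)" "of_nat (Suc n choose Suc j) \<noteq> (0::complex)"
      using j by (simp_all del: of_nat_Suc binomial_Suc_Suc)
    \<comment> \<open>Two absorption identities convert the binomial weights of degree
      \<open>Suc n\<close> into those of degree \<open>n\<close>; the leftover factors are exactly
      those in \<open>coeff_polar\<close>.\<close>
    have "(Suc n - j) * (Suc n choose j) = Suc n * (n choose j)"
      using binomial_absorb_comp[of "Suc n" j] by simp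
    then have "of_nat (Suc n - j) * of_nat (Suc n choose j) = (of_nat (Suc n) * of_nat (n choose j) :: complex)"
      by (metis of_nat_mult)
    then have e1: "(of_nat (Suc n) - of_nat j) * of_nat (Suc n choose j) = (of_nat (Suc n) * of_nat (n choose j) :: complex)"
      using j by (simp add: of_nat_diff)
    have "Suc j * (Suc n choose Suc j) = Suc n * (n choose j)"
      using Suc_times_binomial_eq[of n j] by (simp only: mult.commute)
    then have e2: "of_nat (Suc j) * of_nat (Suc n choose Suc j) = (of_nat (Suc n) * of_nat (n choose j) :: complex)"
      by (metis of_nat_mult)
    have f1: "(of_nat (Suc n) - of_nat j) / of_nat (Suc n) / of_nat (n choose j) = (1 / of_nat (Suc n choose j) :: complex)"
      using e1 nz by (simp add: field_simps del: of_nat_Suc binomial_Suc_Suc)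
    have f2: "of_nat (Suc j) / of_nat (Suc n) / of_nat (n choose j) = (1 / of_nat (Suc n choose Suc j) :: complex)"
      using e2 nz by (simp add: field_simps del: of_nat_Suc binomial_Suc_Suc)
    have "(-1) ^ (n - j) * coeff (polar (Suc n) x \<rho> p) j * coeff r j / of_nat (n choose j) * x ^ j
      = (-1) ^ (n - j) * coeff r j * x ^ j *
         (\<rho> * coeff p j * ((of_nat (Suc n) - of_nat j) / of_nat (Suc n) / of_nat (n choose j))
          + x * coeff p (Suc j) * (of_nat (Suc j) / of_nat (Suc n) / of_nat (n choose j)))"
      unfolding coeff_polar by (simp add: algebra_simps add_divide_distrib del: of_nat_Suc)
    also have "\<dots> = a (Suc j) - b j"
      unfolding f1 f2 a_def b_def c_def using j
      by (simp add: Suc_diff_le algebra_simps del: of_nat_Suc binomial_Suc_Suc)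
    finally show "a (Suc j) - b j = (-1) ^ (n - j) * coeff (polar (Suc n) x \<rho> p) j * coeff r j / of_nat (n choose j) * x ^ j" ..
  qed
  finally show ?thesis .
qed

section \<open>Laguerre's theorem and nonvanishing on the upper half-plane\<close>

lemma poly_pderiv_root_poly:
  fixes y :: "'a::{field}"
  assumes "y \<notin># A"
  shows "poly (pderiv (root_poly A)) y = poly (root_poly A) y * (\<Sum>a\<in>#A. 1 / (y - a))"
  using assms
  by (induction A) (auto simp: pderiv_mult pderiv_pCons poly_root_poly_eq_0_iff field_simps simp del: mult_pCons_left)

lemma sum_inverse_lower_halfplane:
  assumes "\<And>a. a \<in># A \<Longrightarrow> Im a \<le> 0" and "Im y > 0" and "A \<noteq> {#}"
  defines "S \<equiv> \<Sum>a\<in>#A. 1 / (y - a)"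
  shows "Im S < 0" and "(norm S)\<^sup>2 * Im y \<le> - real (size A) * Im S"
proof -
  \<comment> \<open>The map a \<mapsto> 1 / (y - a) sends the closed lower half-plane into the disc with
    centre -iR and radius R; the mean of the summands stays in this convex set.\<close>
  define R where "R = 1 / (2 * Im y)"
  have R: "R > 0" "2 * R * Im y = 1" using assms(2) by (simp_all add: R_def)
  have key: "Im w < 0" "norm (w + \<i> * R) \<le> R" if "Im a \<le> 0" and w: "w = 1 / (y - a)" for a w
  proof -
    have nz: "y - a \<noteq> 0" using that assms(2) by auto
    define N where "N = (cmod (y - a))\<^sup>2"
    have N: "N > 0" using nz by (simp add: N_def)
    have "Im w = - (Im y - Im a) / N"
      by (simp add: w N_def Im_divide cmod_power2)
    moreover have "Im y - Im a > 0" using that(1) assms(2) by simp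
    ultimately show "Im w < 0" using N by (simp add: divide_neg_pos)
    have "(norm w)\<^sup>2 = 1 / N" by (simp add: w N_def norm_divide power_divide)
    have "Im y / N \<le> - Im w" using \<open>Im w = _\<close> N that by (simp add: field_simps)
    then have "2 * R * (Im y / N) \<le> 2 * R * (- Im w)" using R(1) by (intro mult_left_mono) auto
    then have *: "1 / N \<le> - 2 * R * Im w" using R(2) by (metis (no_types, lifting) minus_mult_commute mult.assoc mult_minus_left times_divide_eq_right)
    \<comment> \<open>Completing the square: membership in the disc amounts to
      \<open>(norm w)\<^sup>2 \<le> - 2 * R * Im w\<close>, and the same computation below undoes
      this for \<open>S\<close>.\<close>
    have "(norm (w + \<i> * R))\<^sup>2 = (norm w)\<^sup>2 + 2 * R * Im w + R\<^sup>2"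
      unfolding cmod_power2 by (simp add: power2_eq_square algebra_simps)
    also have "\<dots> \<le> R\<^sup>2" using * \<open>(norm w)\<^sup>2 = _\<close> by simp
    finally show "norm (w + \<i> * R) \<le> R" using R(1) by (meson less_imp_le power2_le_imp_le)
  qed
  have *: "Im S < 0 \<and> norm (S + \<i> * R * size A) \<le> R * size A"
    unfolding S_def using assms(1,3)
  proof (induction A)
    case (add a A)
    have k: "Im (1 / (y - a)) < 0" "norm (1 / (y - a) + \<i> * R) \<le> R" using key add.prems by auto
    show ?case
    proof (cases "A = {#}")
      case True
      with k show ?thesis by simp
    next
      case False
      let ?S = "\<Sum>a\<in>#A. 1 / (y - a)"
      have IH: "Im ?S < 0" "norm (?S + \<i> * R * size A) \<le> R * size A" using add False by auto
      have "norm ((1 / (y - a) + \<i> * R) + (?S + \<i> * R * size A)) \<le> R + R * size A"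
        using norm_triangle_mono[OF k(2) IH(2)] .
      with k IH show ?thesis by (simp add: algebra_simps)
    qed
  qed simp
  then show "Im S < 0" by simp
  from * have "(norm (S + \<i> * R * size A))\<^sup>2 \<le> (R * size A)\<^sup>2" by (intro power_mono) auto
  moreover have "(norm (S + \<i> * R * size A))\<^sup>2 = (norm S)\<^sup>2 + 2 * R * size A * Im S + (R * size A)\<^sup>2"
    unfolding cmod_power2 by (simp add: power2_eq_square algebra_simps)
  ultimately have "(norm S)\<^sup>2 \<le> - 2 * R * size A * Im S" by simp
  then have "(norm S)\<^sup>2 * Im y \<le> - 2 * R * size A * Im S * Im y"
    using assms(2) by (intro mult_right_mono) auto
  also have "\<dots> = - (2 * R * Im y) * size A * Im S" by simp
  finally show "(norm S)\<^sup>2 * Im y \<le> - real (size A) * Im S" by (simp add: R(2))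
qed

text \<open>Laguerre's theorem. With \<open>S\<close> the logarithmic derivative and
  \<open>m\<close> the number of roots, a zero \<open>y\<close> of the polar derivative forces
  \<open>x = \<rho> * (y - m / S)\<close>. The bound on \<open>S\<close> says that
  \<open>m / S\<close> has imaginary part at least \<open>Im y\<close>, which contradicts
  \<open>Im x > 0\<close>.\<close>

lemma poly_polar_nonzero:
  assumes A: "\<And>a. a \<in># A \<Longrightarrow> Im a \<le> 0" and "A \<noteq> {#}" and "\<rho> \<ge> 0" "Im x > 0" "Im y > 0"
  shows "poly (polar (size A) x (of_real \<rho>) (root_poly A)) y \<noteq> 0"
proof
  assume 0: "poly (polar (size A) x (of_real \<rho>) (root_poly A)) y = 0"
  define S where "S = (\<Sum>a\<in>#A. 1 / (y - a))"
  have y: "y \<notin># A" using A \<open>Im y > 0\<close> by fastforce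
  have S: "Im S < 0" "(norm S)\<^sup>2 * Im y \<le> - real (size A) * Im S"
    unfolding S_def using sum_inverse_lower_halfplane assms by auto
  define m where "m = real (size A)"
  have m: "m > 0" using \<open>A \<noteq> {#}\<close> by (simp add: m_def nonempty_has_size)
  have "poly (root_poly A) y * (\<rho> + (x - \<rho> * y) * S / m) = 0"
    using 0 poly_pderiv_root_poly[OF y]
    by (simp add: polar_def S_def m_def algebra_simps diff_divide_distrib)
  then have "\<rho> + (x - \<rho> * y) * S / m = 0"
    using y poly_root_poly_eq_0_iff mult_eq_0_iff by metis
  moreover have "S \<noteq> 0" using S(1) by auto
  ultimately have x: "x = \<rho> * (y - m / S)" using m by (simp add: field_simps)
  have "Im (m / S) = - m * Im S / (norm S)\<^sup>2" by (simp add: Im_divide cmod_power2)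
  also have "\<dots> \<ge> Im y" using S(2) \<open>S \<noteq> 0\<close> by (simp add: m_def field_simps)
  finally have "\<rho> * (Im y - Im (m / S)) \<le> 0" using \<open>\<rho> \<ge> 0\<close> by (simp add: mult_nonneg_nonpos)
  then show False using x \<open>Im x > 0\<close> by simp
qed

text \<open>By Vieta this coefficient is minus the sum of the roots.\<close>

lemma Im_coeff_root_poly:
  assumes "\<And>a. a \<in># A \<Longrightarrow> Im a \<le> 0" and "size A = Suc n"
  shows "Im (coeff (root_poly A) n) \<ge> 0"
  using assms
proof (induction A arbitrary: n)
  case (add a A)
  have c: "coeff (root_poly A) n = 1" using coeff_root_poly_size[of A] add.prems by simp
  show ?case
  proof (cases n)
    case 0
    then show ?thesis using add.prems by simp
  next
    case (Suc k)
    have "Im (coeff (root_poly A) k) \<ge> 0" using add Suc by simp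
    moreover have "Im a \<le> 0" using add.prems by simp
    ultimately show ?thesis using c Suc by simp
  qed
qed simp

text \<open>The polar derivative has the same shape as \<open>root_poly A\<close> with one root
  fewer, so it can be fed back into the induction. Its top coefficient has imaginary part at least
  \<open>Im x > 0\<close>, so the degree is exactly \<open>n\<close>; Laguerre's theorem locates the
  roots.\<close>

lemma polar_root_poly_factor:
  assumes A: "\<And>a. a \<in># A \<Longrightarrow> Im a \<le> 0" and sz: "size A = Suc n" and "\<rho> \<ge> 0" "Im x > 0"
  obtains c B where "c \<noteq> 0" "size B = n" "\<And>b. b \<in># B \<Longrightarrow> Im b \<le> 0"
    "polar (Suc n) x (of_real \<rho>) (root_poly A) = smult c (root_poly B)"
proof -
  let ?q = "polar (Suc n) x (of_real \<rho>) (root_poly A)"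
  have "coeff ?q n = of_real (\<rho> / Suc n) * coeff (root_poly A) n + x"
    using coeff_root_poly_size[of A] sz unfolding coeff_polar
    by (simp del: of_nat_Suc) (simp add: field_simps)
  then have "Im (coeff ?q n) = \<rho> * Im (coeff (root_poly A) n) / Suc n + Im x"
    by simp
  moreover have "\<rho> * Im (coeff (root_poly A) n) / Suc n \<ge> 0"
    using Im_coeff_root_poly[OF A sz] \<open>\<rho> \<ge> 0\<close> by simp
  ultimately have n: "coeff ?q n \<noteq> 0" using \<open>Im x > 0\<close> by auto
  have "coeff ?q i = 0" if "i > n" for i
    using that sz by (cases "i = Suc n") (simp_all add: coeff_polar coeff_eq_0 degree_root_poly)
  then have deg: "degree ?q = n"
    using n by (intro antisym degree_le le_degree) auto
  have q0: "?q \<noteq> 0" using n by auto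
  obtain B where B: "size B = degree ?q" "?q = smult (lead_coeff ?q) (root_poly B)"
    using alg_closed_imp_factorization[OF q0] by blast
  have "Im b \<le> 0" if "b \<in># B" for b
  proof (rule ccontr)
    assume "\<not> Im b \<le> 0"
    moreover have "A \<noteq> {#}" using sz by auto
    ultimately have "poly ?q b \<noteq> 0"
      using poly_polar_nonzero[of A \<rho> x b] sz A \<open>\<rho> \<ge> 0\<close> \<open>Im x > 0\<close> by simp
    moreover have "poly ?q b = lead_coeff ?q * poly (root_poly B) b"
      by (metis B(2) poly_smult)
    moreover have "poly (root_poly B) b = 0"
      using that poly_root_poly_eq_0_iff by metis
    ultimately show False by simp
  qed
  moreover have "lead_coeff ?q \<noteq> 0" using q0 by simp
  ultimately show ?thesis
    using B deg by (intro that[of "lead_coeff ?q" B]) simp_all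
qed

text \<open>Each root of \<open>R\<close> costs one polar derivative of the first factor, with
  \<open>x\<close> fixed throughout; after the last one only a product of nonzero constants
  remains.\<close>

theorem conv_val_nonzero:
  assumes "\<And>a. a \<in># A \<Longrightarrow> Im a \<le> 0" and "size A = size R"
    and "\<And>\<rho>. \<rho> \<in># R \<Longrightarrow> \<rho> \<ge> (0::real)" and "Im x > 0"
  shows "conv_val (size R) (root_poly A) (root_poly (image_mset of_real R)) x \<noteq> 0"
  using assms(1-3)
proof (induction R arbitrary: A)
  case empty
  then show ?case by (simp add: conv_val_def)
next
  case (add \<rho> R)
  have "\<rho> \<ge> 0" "size A = Suc (size R)" using add.prems by simp_all
  then obtain c B where B: "c \<noteq> 0" "size B = size R" "\<And>b. b \<in># B \<Longrightarrow> Im b \<le> 0"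
    "polar (Suc (size R)) x (of_real \<rho>) (root_poly A) = smult c (root_poly B)"
    using polar_root_poly_factor[of A "size R" \<rho> x] add.prems(1) \<open>Im x > 0\<close> by metis
  have "conv_val (Suc (size R)) (root_poly A) ([:- of_real \<rho>, 1:] * root_poly (image_mset of_real R)) x
      = conv_val (size R) (polar (Suc (size R)) x (of_real \<rho>) (root_poly A)) (root_poly (image_mset of_real R)) x"
    by (rule conv_val_mult_linear) (simp add: degree_root_poly)
  also have "\<dots> = c * conv_val (size R) (root_poly B) (root_poly (image_mset of_real R)) x"
    by (simp add: B(4) conv_val_smult)
  also have "\<dots> \<noteq> 0"
    using B add by simp
  finally show ?case by simp
qed

section \<open>Counting real roots through arguments near the real axis\<close>

definition count_le :: "real multiset \<Rightarrow> real \<Rightarrow> nat" where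
  "count_le A x = size {#a \<in># A. a \<le> x#}"

lemma count_le_empty [simp]: "count_le {#} x = 0"
  by (simp add: count_le_def)

lemma count_le_add_mset [simp]: "count_le (add_mset a A) x = (if a \<le> x then 1 else 0) + count_le A x"
  by (simp add: count_le_def)

lemma count_le_le_size: "count_le A x \<le> size A"
  by (simp add: count_le_def size_filter_mset_lesseq)

lemma count_le_eq_size_iff: "count_le A x = size A \<longleftrightarrow> (\<forall>a\<in>#A. a \<le> x)"
proof (induction A)
  case (add a A)
  then show ?case using count_le_le_size[of A x] by auto
qed simp

lemma tendsto_sum_mset:
  fixes f :: "'a \<Rightarrow> 'b \<Rightarrow> 'c::topological_comm_monoid_add"
  assumes "\<And>a. a \<in># A \<Longrightarrow> ((\<lambda>t. f a t) \<longlongrightarrow> l a) F"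
  shows "((\<lambda>t. \<Sum>a\<in>#A. f a t) \<longlongrightarrow> (\<Sum>a\<in>#A. l a)) F"
  using assms by (induction A) (auto intro!: tendsto_add)

lemma continuous_on_sum_mset:
  fixes f :: "'a \<Rightarrow> 'b::topological_space \<Rightarrow> 'c::topological_comm_monoid_add"
  assumes "\<And>a. a \<in># A \<Longrightarrow> continuous_on S (f a)"
  shows "continuous_on S (\<lambda>t. \<Sum>a\<in>#A. f a t)"
  using assms by (induction A) (auto intro!: continuous_on_add)

text \<open>Measuring the angle from the imaginary axis lets \<open>arctan\<close> cover the whole
  upper half-plane without a case distinction.\<close>

lemma Complex_arctan_polar:
  assumes "s > 0"
  shows "Complex (- (s * w)) s = of_real (s * sqrt (1 + w\<^sup>2)) * cis (pi / 2 + arctan w)"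
proof -
  have "sqrt (1 + w\<^sup>2) \<noteq> 0" by (smt (verit) real_sqrt_eq_zero_cancel_iff zero_le_power2)
  then show ?thesis
    by (simp add: complex_eq_iff cos_add sin_add sin_arctan cos_arctan)
qed

text \<open>Points of the upper half-plane are approached along the curve x + t + i t\<open>\<^sup>2\<close>. It reaches x
  tangentially to the real axis from the right, so that as t tends to 0 the root x itself is counted
  like the roots below x.\<close>
definition angle_sum :: "real multiset \<Rightarrow> real \<Rightarrow> real \<Rightarrow> real" where
  "angle_sum A x t = (\<Sum>a\<in>#A. arctan ((a - x - t) / t\<^sup>2))"

text \<open>Adding the angles of the linear factors gives an argument of the product that is
  continuous in \<open>t\<close>; a principal argument would jump.\<close>

lemma poly_root_poly_polar_form:
  assumes "t > 0"
  shows "\<exists>\<rho>>0. poly (root_poly (image_mset complex_of_real A)) (Complex (x + t) (t\<^sup>2))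
           = of_real \<rho> * cis (real (size A) * (pi / 2) + angle_sum A x t)"
proof (induction A)
  case empty
  show ?case by (intro exI[of _ 1]) (simp add: angle_sum_def)
next
  case (add a A)
  then obtain \<rho> where \<rho>: "\<rho> > 0"
    "poly (root_poly (image_mset complex_of_real A)) (Complex (x + t) (t\<^sup>2))
       = of_real \<rho> * cis (real (size A) * (pi / 2) + angle_sum A x t)" by blast
  define w where "w = (a - x - t) / t\<^sup>2"
  define \<sigma> where "\<sigma> = t\<^sup>2 * sqrt (1 + w\<^sup>2)"
  have "\<sigma> > 0" using assms by (simp add: \<sigma>_def add_pos_nonneg)
  have "Complex (x + t) (t\<^sup>2) - of_real a = Complex (- (t\<^sup>2 * w)) (t\<^sup>2)"
    using assms by (simp add: complex_eq_iff w_def)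
  also have "\<dots> = of_real \<sigma> * cis (pi / 2 + arctan w)"
    unfolding \<sigma>_def by (rule Complex_arctan_polar) (use assms in simp)
  finally have factor: "Complex (x + t) (t\<^sup>2) - of_real a = of_real \<sigma> * cis (pi / 2 + arctan w)" .
  have "poly (root_poly (image_mset complex_of_real (add_mset a A))) (Complex (x + t) (t\<^sup>2))
     = (Complex (x + t) (t\<^sup>2) - of_real a) * poly (root_poly (image_mset complex_of_real A)) (Complex (x + t) (t\<^sup>2))"
    unfolding poly_root_poly by simp
  also have "\<dots> = (of_real \<sigma> * cis (pi / 2 + arctan w)) *
       (of_real \<rho> * cis (real (size A) * (pi / 2) + angle_sum A x t))"
    unfolding factor \<rho>(2) ..
  also have "\<dots> = of_real (\<sigma> * \<rho>) * 
     (cis (pi / 2 + arctan w) * cis (real (size A) * (pi / 2) + angle_sum A x t))"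
    by (simp add: mult_ac)
  also have "cis (pi / 2 + arctan w) * cis (real (size A) * (pi / 2) + angle_sum A x t)
      = cis (real (size (add_mset a A)) * (pi / 2) + angle_sum (add_mset a A) x t)"
    unfolding cis_mult by (rule arg_cong[of _ _ cis]) (simp add: angle_sum_def w_def field_simps)
  finally show ?case using \<open>\<sigma> > 0\<close> \<rho>(1) by (intro exI[of _ "\<sigma> * \<rho>"]) simp
qed

lemma continuous_on_angle_sum: "continuous_on {0<..} (angle_sum A x)"
  unfolding angle_sum_def
  by (intro continuous_on_sum_mset continuous_intros) auto

text \<open>Fixes the branch: far out on the curve all directions become vertical, so every angle
  measured from the imaginary axis tends to 0.\<close>

lemma angle_sum_at_top: "(angle_sum A x \<longlongrightarrow> 0) at_top"
proof -
  have "((\<lambda>t. arctan ((a - x - t) / t\<^sup>2)) \<longlongrightarrow> 0) at_top" for a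
  proof -
    have "((\<lambda>t. (a - x - t) / t\<^sup>2) \<longlongrightarrow> 0) at_top" by real_asymp
    from tendsto_arctan[OF this] show ?thesis by simp
  qed
  then have "((\<lambda>t. \<Sum>a\<in>#A. arctan ((a - x - t) / t\<^sup>2)) \<longlongrightarrow> (\<Sum>a\<in>#A. 0)) at_top"
    by (intro tendsto_sum_mset)
  then show ?thesis by (simp add: angle_sum_def [abs_def])
qed

text \<open>In the limit a factor contributes \<open>- (pi / 2)\<close> if its root is at most
  \<open>x\<close> and \<open>pi / 2\<close> otherwise, so the angle sum encodes the root
  count.\<close>

lemma angle_sum_at_right_0:
  "(angle_sum A x \<longlongrightarrow> (pi / 2) * (real (size A) - 2 * real (count_le A x))) (at_right 0)"
proof -
  have "((\<lambda>t. arctan ((a - x - t) / t\<^sup>2)) \<longlongrightarrow> (if a \<le> x then - (pi / 2) else pi / 2)) (at_right 0)" for a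
  proof (cases "a \<le> x")
    case True
    have "filterlim (\<lambda>t. (a - x - t) / t\<^sup>2) at_bot (at_right 0)"
    proof (cases "a = x")
      case True
      then have "(\<lambda>t. (a - x - t) / t\<^sup>2) = (\<lambda>t. - t / t\<^sup>2)" by simp
      moreover have "filterlim (\<lambda>t::real. - t / t\<^sup>2) at_bot (at_right 0)" by real_asymp
      ultimately show ?thesis by simp
    next
      case False
      define c where "c = x - a"
      have "c > 0" using True False by (simp add: c_def)
      then have "filterlim (\<lambda>t. (- c - t) / t\<^sup>2) at_bot (at_right 0)" by real_asymp
      then show ?thesis by (simp add: c_def)
    qed
    then show ?thesis
      using True filterlim_compose[OF tendsto_arctan_at_bot] by simp
  next
    case False
    define c where "c = a - x"
    have "c > 0" using False by (simp add: c_def)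
    then have "filterlim (\<lambda>t. (c - t) / t\<^sup>2) at_top (at_right 0)" by real_asymp
    then have "filterlim (\<lambda>t. (a - x - t) / t\<^sup>2) at_top (at_right 0)" by (simp add: c_def)
    then show ?thesis
      using False filterlim_compose[OF tendsto_arctan_at_top] by simp
  qed
  then have "((\<lambda>t. \<Sum>a\<in>#A. arctan ((a - x - t) / t\<^sup>2)) \<longlongrightarrow>
      (\<Sum>a\<in>#A. if a \<le> x then - (pi / 2) else pi / 2)) (at_right 0)"
    by (intro tendsto_sum_mset)
  moreover have "(\<Sum>a\<in>#A. if a \<le> x then - (pi / 2) else pi / 2) =
      (pi / 2) * (real (size A) - 2 * real (count_le A x))"
    by (induction A) (simp_all add: algebra_simps)
  ultimately show ?thesis by (simp add: angle_sum_def [abs_def])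
qed

text \<open>The function \<Theta> is a continuous argument of the quotient. It starts at 0 for large
  \<open>t\<close>, cannot cross \<open>pi\<close> or \<open>- pi\<close>, and is never positive;
  its limit at 0 is \<open>pi\<close> times an integer, which is therefore 0 or -1.\<close>

lemma count_le_interlace:
  assumes "size U = size V"
    and quot: "\<And>z. Im z > 0 \<Longrightarrow>
      (let q = poly (root_poly (image_mset complex_of_real U)) z / poly (root_poly (image_mset complex_of_real V)) z
       in q = 1 \<or> Im q < 0)"
  shows "count_le V x \<le> count_le U x" and "count_le U x \<le> count_le V x + 1"
proof -
  define \<Theta> where "\<Theta> t = angle_sum U x t - angle_sum V x t" for t
  \<comment> \<open>The modulus of the quotient is positive, and it is 1 when the quotient is 1, so
    the hypothesis becomes a condition on \<Theta> alone.\<close>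
  have polar: "cis (\<Theta> t) = 1 \<or> sin (\<Theta> t) < 0" if t: "t > 0" for t
  proof -
    obtain \<rho> \<sigma> where "\<rho> > 0" "\<sigma> > 0" and
      "poly (root_poly (image_mset complex_of_real U)) (Complex (x + t) (t\<^sup>2))
           = of_real \<rho> * cis (real (size U) * (pi / 2) + angle_sum U x t)"
      "poly (root_poly (image_mset complex_of_real V)) (Complex (x + t) (t\<^sup>2))
           = of_real \<sigma> * cis (real (size V) * (pi / 2) + angle_sum V x t)"
      using poly_root_poly_polar_form[OF t, of U x] poly_root_poly_polar_form[OF t, of V x] by blast
    then have "poly (root_poly (image_mset complex_of_real U)) (Complex (x + t) (t\<^sup>2)) /
          poly (root_poly (image_mset complex_of_real V)) (Complex (x + t) (t\<^sup>2))
        = of_real (\<rho> / \<sigma>) * (cis (real (size U) * (pi / 2) + angle_sum U x t) / cis (real (size V) * (pi / 2) + angle_sum V x t))"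
      by simp
    also have "\<dots> = of_real (\<rho> / \<sigma>) * cis (\<Theta> t)"
      unfolding cis_divide by (simp add: \<Theta>_def assms(1))
    finally have *: "of_real (\<rho> / \<sigma>) * cis (\<Theta> t) = 1 \<or> Im (of_real (\<rho> / \<sigma>) * cis (\<Theta> t)) < 0"
      using quot[of "Complex (x + t) (t\<^sup>2)"] t by (simp add: Let_def)
    define m where "m = \<rho> / \<sigma>"
    have m: "m > 0" using \<open>\<rho> > 0\<close> \<open>\<sigma> > 0\<close> by (simp add: m_def)
    from * consider "of_real m * cis (\<Theta> t) = 1" | "m * sin (\<Theta> t) < 0" by (auto simp: m_def)
    then show ?thesis
    proof cases
      case 1
      then have "norm (of_real m * cis (\<Theta> t)) = 1" by simp
      then have "m = 1" using m by (simp add: norm_mult)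
      with 1 show ?thesis by simp
    next
      case 2
      then show ?thesis using m by (simp add: mult_less_0_iff)
    qed
  qed
  have cont: "continuous_on {0<..} \<Theta>"
    unfolding \<Theta>_def by (intro continuous_intros continuous_on_angle_sum)
  have top: "(\<Theta> \<longlongrightarrow> 0) at_top"
    using tendsto_diff[OF angle_sum_at_top angle_sum_at_top] by (simp add: \<Theta>_def [abs_def])
  \<comment> \<open>At these values \<open>cis\<close> is -1 and \<open>sin\<close> is 0, so both
    alternatives of \<open>polar\<close> fail.\<close>
  have not_pi: "\<bar>\<Theta> t\<bar> \<noteq> pi" if "t > 0" for t
  proof
    assume "\<bar>\<Theta> t\<bar> = pi"
    then have "\<Theta> t = pi \<or> \<Theta> t = - pi" by linarith
    then show False using polar[OF that] by (auto simp: complex_eq_iff)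
  qed
  have less_pi: "\<bar>\<Theta> t\<bar> < pi" if "t > 0" for t
  proof (rule ccontr)
    assume "\<not> \<bar>\<Theta> t\<bar> < pi"
    \<comment> \<open>The limit at infinity supplies a point \<open>s\<close> beyond
      \<open>t\<close> where the bound holds; leaving it between \<open>t\<close> and
      \<open>s\<close> would mean hitting \<open>pi\<close>.\<close>
    have "\<forall>\<^sub>F s in at_top. \<bar>\<Theta> s\<bar> < pi"
      using tendstoD[OF top pi_gt_zero] by (simp add: dist_real_def)
    then have "\<forall>\<^sub>F s in at_top. \<bar>\<Theta> s\<bar> < pi \<and> t \<le> s"
      using eventually_ge_at_top eventually_conj by blast
    then obtain s where s: "\<bar>\<Theta> s\<bar> < pi" "t \<le> s"
      using eventually_happens' trivial_limit_at_top_linorder by blast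
    have "continuous_on {t..s} (\<lambda>u. \<bar>\<Theta> u\<bar>)"
      using that by (intro continuous_intros continuous_on_subset[OF cont]) auto
    then obtain u where "t \<le> u" "\<bar>\<Theta> u\<bar> = pi"
      using IVT2'[of "\<lambda>u. \<bar>\<Theta> u\<bar>" s pi t] s \<open>\<not> \<bar>\<Theta> t\<bar> < pi\<close> by auto
    then show False using not_pi[of u] that by simp
  qed
  have nonpos: "\<Theta> t \<le> 0" if "t > 0" for t
  proof (rule ccontr)
    assume "\<not> \<Theta> t \<le> 0"
    then have "sin (\<Theta> t) > 0" using less_pi[OF that] by (intro sin_gt_zero) auto
    then show False using polar[OF that] by (auto simp: complex_eq_iff)
  qed
  \<comment> \<open>Since the sizes agree, only the difference of the counts survives in the limit
    of the two angle sums.\<close>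
  define L where "L = pi * (real (count_le V x) - real (count_le U x))"
  have L: "(\<Theta> \<longlongrightarrow> L) (at_right 0)"
    using tendsto_diff[OF angle_sum_at_right_0[of U x] angle_sum_at_right_0[of V x]] assms(1)
    by (simp add: \<Theta>_def [abs_def] L_def algebra_simps)
  have pos: "\<forall>\<^sub>F t in at_right (0::real). t > 0"
    by (simp add: eventually_at_right_less)
  have "L \<le> 0"
    by (rule tendsto_upperbound[OF L]) (use pos nonpos in \<open>auto elim: eventually_mono\<close>)
  then have "real (count_le V x) - real (count_le U x) \<le> 0"
    by (metis L_def mult_le_0_iff not_le pi_gt_zero)
  then show "count_le V x \<le> count_le U x" by simp
  have "\<forall>\<^sub>F t in at_right 0. - pi \<le> \<Theta> t"
    using pos by eventually_elim (use less_pi in fastforce)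
  then have "- pi \<le> L"
    by (intro tendsto_lowerbound[OF L]) auto
  then have "pi * (-1) \<le> pi * (real (count_le V x) - real (count_le U x))"
    by (simp add: L_def)
  then have "-1 \<le> real (count_le V x) - real (count_le U x)"
    by (subst (asm) mult_le_cancel_left_pos) auto
  then show "count_le U x \<le> count_le V x + 1" by linarith
qed

section \<open>Real-rootedness of the convolution\<close>

abbreviation cpoly :: "real poly \<Rightarrow> complex poly" where
  "cpoly \<equiv> map_poly of_real"

lemma cpoly_mult: "cpoly (p * q) = cpoly p * cpoly q"
  by (intro poly_eqI) (simp add: coeff_map_poly coeff_mult)

lemma cpoly_root_poly: "cpoly (root_poly A) = root_poly (image_mset of_real A)"
  by (induction A) (simp_all add: cpoly_mult map_poly_pCons del: mult_pCons_left)

lemma cpoly_eq_iff: "cpoly p = cpoly q \<longleftrightarrow> p = q"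
  by (auto simp: poly_eq_iff coeff_map_poly)

text \<open>Reindexed by the exponent \<open>j = d - k\<close>, the binomial factor cancels one of
  the two normalising denominators; this is the form used in \<open>conv_val\<close>.\<close>

lemma coeff_mconv:
  "coeff (mconv d p r) j =
    (if j \<le> d then (-1) ^ (d - j) * coeff p j * coeff r j / real (d choose j) else 0)"
proof (cases "j \<le> d")
  case True
  have "coeff (mconv d p r) j =
     (\<Sum>k\<le>d. if k = d - j then (-1) ^ k * real (d choose k) * etilde d p k * etilde d r k else 0)"
    unfolding mconv_def coeff_sum coeff_monom using True by (intro sum.cong refl) auto
  also have "\<dots> = (-1) ^ (d - j) * real (d choose (d - j)) * etilde d p (d - j) * etilde d r (d - j)"
    by simp
  also have "\<dots> = (-1) ^ (d - j) * coeff p j * coeff r j / real (d choose j)"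
    using True by (simp add: etilde_def binomial_symmetric[of j d] field_simps flip: power_mult_distrib)
  finally show ?thesis using True by simp
next
  case False
  then show ?thesis unfolding mconv_def coeff_sum coeff_monom by (auto intro!: sum.neutral)
qed

lemma poly_cpoly_mconv: "poly (cpoly (mconv d p r)) z = conv_val d (cpoly p) (cpoly r) z"
proof -
  have "degree (cpoly (mconv d p r)) \<le> d"
    by (rule degree_le) (simp add: coeff_map_poly coeff_mconv)
  then have "poly (cpoly (mconv d p r)) z = (\<Sum>j\<le>d. coeff (cpoly (mconv d p r)) j * z ^ j)"
    unfolding poly_altdef by (intro sum.mono_neutral_left) (auto simp: coeff_eq_0)
  also have "\<dots> = conv_val d (cpoly p) (cpoly r) z"
    unfolding conv_val_def by (intro sum.cong refl) (simp add: coeff_map_poly coeff_mconv)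
  finally show ?thesis .
qed

text \<open>Factor over the complex numbers, replace each root by its real part, and descend by
  injectivity of \<open>cpoly\<close>.\<close>

lemma real_rooted_eq_root_poly:
  fixes q :: "real poly"
  assumes "lead_coeff q = 1" and "\<And>z. poly (cpoly q) z = 0 \<Longrightarrow> Im z = 0"
  shows "q = root_poly (proots q)" and "size (proots q) = degree q"
proof -
  have "lead_coeff (cpoly q) = 1" using assms(1) by (simp add: degree_map_poly coeff_map_poly)
  moreover from this have "cpoly q \<noteq> 0" by auto
  ultimately obtain B where B: "cpoly q = root_poly B"
    using alg_closed_imp_factorization[of "cpoly q"] by auto
  have "of_real (Re b) = b" if "b \<in># B" for b
    using that assms(2)[of b] B poly_root_poly_eq_0_iff[of B b] by (simp add: complex_eq_iff)
  then have "B = image_mset of_real (image_mset Re B)"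
    by (simp add: multiset.map_comp comp_def cong: image_mset_cong)
  then have "cpoly q = cpoly (root_poly (image_mset Re B))"
    using B cpoly_root_poly by metis
  then have q: "q = root_poly (image_mset Re B)" by (simp add: cpoly_eq_iff)
  then show "q = root_poly (proots q)" "size (proots q) = degree q"
    by (metis proots_root_poly, metis proots_root_poly degree_root_poly)
qed

text \<open>Being total, this collects just the real roots in general; for
  \<open>size A = size R\<close> and nonnegative \<open>R\<close> these are all roots, as shown
  next.\<close>

definition mconv_roots :: "real multiset \<Rightarrow> real multiset \<Rightarrow> real multiset" where
  "mconv_roots R A = proots (mconv (size R) (root_poly A) (root_poly R))"

text \<open>The convolution is monic, has no zero in the upper half-plane, and has real
  coefficients; conjugation excludes the lower half-plane too.\<close>

lemma
  assumes sz: "size A = size R" and R: "\<And>\<rho>. \<rho> \<in># R \<Longrightarrow> \<rho> \<ge> 0"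
  shows mconv_eq_root_poly: "mconv (size R) (root_poly A) (root_poly R) = root_poly (mconv_roots R A)"
    and size_mconv_roots: "size (mconv_roots R A) = size R"
proof -
  let ?q = "mconv (size R) (root_poly A) (root_poly R)"
  have top: "coeff ?q (size R) = 1"
    using coeff_root_poly_size[of A] coeff_root_poly_size[of R] sz by (simp add: coeff_mconv)
  have deg: "degree ?q = size R"
    by (intro antisym degree_le le_degree) (use top in \<open>auto simp: coeff_mconv\<close>)
  have upper: "poly (cpoly ?q) z \<noteq> 0" if "Im z > 0" for z
    unfolding poly_cpoly_mconv cpoly_root_poly
    by (rule conv_val_nonzero) (use sz R that in auto)
  have "Im z = 0" if z: "poly (cpoly ?q) z = 0" for z
  proof (rule ccontr)
    assume "Im z \<noteq> 0"
    moreover have "poly (cpoly ?q) (cnj z) = 0"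
      by (subst real_poly_cnj_root_iff) (use z in \<open>auto simp: coeff_map_poly\<close>)
    ultimately show False using upper[of z] upper[of "cnj z"] z by (cases "Im z > 0") auto
  qed
  then show "?q = root_poly (mconv_roots R A)" "size (mconv_roots R A) = size R"
    unfolding mconv_roots_def using real_rooted_eq_root_poly[of ?q] top deg by simp_all
qed

section \<open>Moving roots and comparing counting functions\<close>

lemma count_le_mconv_roots_move:
  assumes sz: "Suc (size C) = size R" and R: "\<And>\<rho>. \<rho> \<in># R \<Longrightarrow> \<rho> \<ge> 0" and "a \<le> b"
  shows "count_le (mconv_roots R (add_mset b C)) x \<le> count_le (mconv_roots R (add_mset a C)) x"
    and "count_le (mconv_roots R (add_mset a C)) x \<le> count_le (mconv_roots R (add_mset b C)) x + 1"
proof -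
  let ?U = "mconv_roots R (add_mset a C)" and ?V = "mconv_roots R (add_mset b C)"
  have "count_le ?V x \<le> count_le ?U x \<and> count_le ?U x \<le> count_le ?V x + 1" if "a < b"
  proof -
    let ?g = "root_poly (image_mset complex_of_real C)" and ?r = "root_poly (image_mset complex_of_real R)"
    \<comment> \<open>The parameter \<open>c\<close> is complex: real values give the two
      convolutions, while nonreal ones in the lower half-plane control their quotient.\<close>
    define Q where "Q c z = conv_val (size R) ([:-c, 1:] * ?g) ?r z" for c z
    have Q_eq: "poly (root_poly (image_mset complex_of_real (mconv_roots R (add_mset c C)))) z = Q (of_real c) z" for c z
    proof -
      have "poly (root_poly (image_mset complex_of_real (mconv_roots R (add_mset c C)))) z
          = poly (cpoly (mconv (size R) (root_poly (add_mset c C)) (root_poly R))) z"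
        using mconv_eq_root_poly[of "add_mset c C" R] sz R by (simp add: cpoly_root_poly del: mult_pCons_left)
      then show ?thesis
        unfolding poly_cpoly_mconv cpoly_root_poly by (simp add: Q_def)
    qed
    have Q_nz: "Q c z \<noteq> 0" if "Im z > 0" "Im c \<le> 0" for c z
    proof -
      have "conv_val (size R) (root_poly (add_mset c (image_mset of_real C))) ?r z \<noteq> 0"
        by (rule conv_val_nonzero) (use sz R that in auto)
      then show ?thesis by (simp add: Q_def)
    qed
    have quot: "Q a z / Q b z = 1 \<or> Im (Q a z / Q b z) < 0" if z: "Im z > 0" for z
    proof -
      define X where "X = conv_val (size R) ([:0, 1:] * ?g) ?r z"
      define Y where "Y = conv_val (size R) ?g ?r z"
      have Q: "Q c z = X - c * Y" for c
      proof -
        have "[:-c, 1:] * ?g = [:0, 1:] * ?g - smult c ?g" by simp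
        then show ?thesis by (simp only: Q_def X_def Y_def conv_val_diff conv_val_smult)
      qed
      show ?thesis
      proof (cases "Y = 0")
        \<comment> \<open>Here \<open>Q\<close> does not depend on \<open>c\<close>; this is why
          \<open>count_le_interlace\<close> admits quotients equal to 1.\<close>
        case True
        then show ?thesis using Q Q_nz[OF z, of 0] by simp
      next
        case False
        define F where "F = X / Y"
        have QF: "Q c z = (F - c) * Y" for c using False by (simp add: Q F_def field_simps)
        \<comment> \<open>Otherwise \<open>c = F\<close> would be an admissible parameter at which
          \<open>Q\<close> vanishes.\<close>
        have "Im F > 0" using Q_nz[OF z, of F] by (rule_tac ccontr) (simp add: QF)
        then have nz: "F - b \<noteq> 0" by auto
        define N where "N = (cmod (F - b))\<^sup>2"
        have N: "N > 0" using nz by (simp add: N_def)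
        have "Q a z / Q b z = 1 + of_real (b - a) / (F - b)"
          using False nz by (simp add: QF field_simps)
        then have "Im (Q a z / Q b z) = - (b - a) * Im F / N"
          by (simp add: Im_divide N_def cmod_power2 minus_divide_left [symmetric] flip: mult_minus_left)
        also have "\<dots> < 0" using \<open>Im F > 0\<close> \<open>a < b\<close> N by (simp add: divide_neg_pos mult_neg_pos)
        finally show ?thesis by simp
      qed
    qed
    have "size ?U = size ?V" using size_mconv_roots sz R by simp
    then show ?thesis
      using count_le_interlace[of ?U ?V x] quot by (simp add: Let_def Q_eq del: poly_prod_mset)
  qed
  then show "count_le ?V x \<le> count_le ?U x" "count_le ?U x \<le> count_le ?V x + 1"
    using \<open>a \<le> b\<close> by (cases "a = b"; simp)+
qed

text \<open>The common part \<open>C\<close> absorbs the roots already treated, so that the total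
  number of roots stays \<open>size R\<close> while \<open>A\<close> and \<open>B\<close>
  shrink.\<close>

lemma count_le_mconv_roots_mono:
  assumes R: "\<And>\<rho>. \<rho> \<in># R \<Longrightarrow> \<rho> \<ge> 0"
    and "size A = size B" "size A + size C = size R" "\<And>x. count_le A x \<le> count_le B x"
  shows "count_le (mconv_roots R (A + C)) x \<le> count_le (mconv_roots R (B + C)) x"
  using assms(2-)
proof (induction "size A" arbitrary: A B C)
  case 0
  then show ?case by simp
next
  case (Suc n)
  then have ne: "A \<noteq> {#}" "B \<noteq> {#}" by auto
  \<comment> \<open>Trading the largest root of A for the largest root of B is a single move to the left.\<close>
  define \<alpha> where "\<alpha> = Max_mset A"
  define \<beta> where "\<beta> = Max_mset B"
  obtain A0 where A: "A = add_mset \<alpha> A0" by (metis \<alpha>_def Max_in_mset multi_member_split ne(1))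
  obtain B0 where B: "B = add_mset \<beta> B0" by (metis \<beta>_def Max_in_mset multi_member_split ne(2))
  have max: "\<forall>a\<in>#A. a \<le> \<alpha>" "\<forall>b\<in>#B. b \<le> \<beta>" by (simp_all add: \<alpha>_def \<beta>_def)
  have "count_le B \<alpha> = size B"
    using Suc.prems(1) Suc.prems(3)[of \<alpha>] count_le_le_size[of B \<alpha>] max(1) count_le_eq_size_iff[of A \<alpha>] by simp
  then have "\<beta> \<le> \<alpha>" unfolding count_le_eq_size_iff using B by simp
  \<comment> \<open>Removing the largest roots could hurt only for \<open>y\<close> from \<beta> up
    to below \<alpha>, where \<open>B\<close> alone loses a counted root; but there all of
    \<open>B0\<close> is counted.\<close>
  have "count_le A0 y \<le> count_le B0 y" for y
  proof (cases "\<beta> \<le> y \<and> y < \<alpha>")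
    case True
    then have "\<forall>b\<in>#B. b \<le> y" using max(2) by force
    then have "count_le B0 y = size B0" using B by (simp add: count_le_eq_size_iff)
    then show ?thesis using count_le_le_size[of A0 y] Suc.prems(1) A B by simp
  next
    case False
    then show ?thesis using Suc.prems(3)[of y] \<open>\<beta> \<le> \<alpha>\<close> by (auto simp: A B split: if_splits)
  qed
  then have "count_le (mconv_roots R (A0 + add_mset \<alpha> C)) x \<le> count_le (mconv_roots R (B0 + add_mset \<alpha> C)) x"
    using Suc.prems Suc.hyps(2) by (intro Suc.hyps(1)) (simp_all add: A B)
  also have "\<dots> \<le> count_le (mconv_roots R (add_mset \<beta> (B0 + C))) x"
    using count_le_mconv_roots_move(1)[of "B0 + C" R \<beta> \<alpha> x] Suc.prems(1,2) R \<open>\<beta> \<le> \<alpha>\<close> by (simp add: A B)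
  finally show ?case by (simp add: A B)
qed

lemma count_le_mconv_roots_shift:
  assumes R: "\<And>\<rho>. \<rho> \<in># R \<Longrightarrow> \<rho> \<ge> 0"
    and "size A = size R" "size B = size R" "\<And>x. count_le A x \<le> count_le B x + k"
  shows "count_le (mconv_roots R A) x \<le> count_le (mconv_roots R B) x + k"
  using assms(2-)
proof (induction k arbitrary: A)
  case 0
  then show ?case using count_le_mconv_roots_mono[of R A B "{#}" x] R by simp
next
  case (Suc k)
  show ?case
  proof (cases "A = {#}")
    case True
    then show ?thesis using Suc.prems by simp
  next
    case False
    \<comment> \<open>Moving the smallest root of A beyond all roots lowers the counting function where it matters
      and changes the counting function of the convolution by at most one.\<close>
    define \<alpha> where "\<alpha> = Min_mset A"
    define M where "M = Max_mset (A + B)"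
    obtain A0 where A: "A = add_mset \<alpha> A0" by (metis \<alpha>_def Min_in_mset multi_member_split False)
    have min: "\<forall>a\<in>#A. \<alpha> \<le> a" by (simp add: \<alpha>_def)
    have M: "a \<le> M" if "a \<in># A \<or> a \<in># B" for a
      using that unfolding M_def by (intro Max_ge) auto
    have "\<alpha> \<le> M" using M A by simp
    have "count_le (add_mset M A0) y \<le> count_le B y + k" for y
    proof -
      \<comment> \<open>Below \<alpha> nothing of \<open>A\<close> is counted; from \<alpha> up to
        \<open>M\<close> the moved root is no longer counted, which saves one; from \<open>M\<close>
        on all of \<open>B\<close> is counted.\<close>
      consider "y < \<alpha>" | "\<alpha> \<le> y" "y < M" | "M \<le> y" by linarith
      then show ?thesis
      proof cases
        case 1
        then have "set_mset {#a \<in># A0. a \<le> y#} = {}" using min A by force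
        then have "{#a \<in># A0. a \<le> y#} = {#}" by (simp only: set_mset_eq_empty_iff)
        then have "count_le A0 y = 0" by (simp only: count_le_def size_empty)
        then show ?thesis using 1 \<open>\<alpha> \<le> M\<close> by simp
      next
        case 2
        then show ?thesis using Suc.prems(3)[of y] by (simp add: A)
      next
        case 3
        then have "\<forall>b\<in>#B. b \<le> y" using M by force
        then have "count_le B y = size B" by (simp add: count_le_eq_size_iff)
        then show ?thesis
          using count_le_le_size[of "add_mset M A0" y] Suc.prems(1,2) A by simp
      qed
    qed
    then have "count_le (mconv_roots R (add_mset M A0)) x \<le> count_le (mconv_roots R B) x + k"
      using Suc.prems A by (intro Suc.IH) simp_all
    moreover have "count_le (mconv_roots R A) x \<le> count_le (mconv_roots R (add_mset M A0)) x + 1"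
      using count_le_mconv_roots_move(2)[of A0 R \<alpha> M x] Suc.prems(1) R \<open>\<alpha> \<le> M\<close> by (simp add: A)
    ultimately show ?thesis by simp
  qed
qed

section \<open>From counting functions to the Kolmogorov distance\<close>

lemma rootcdf_root_poly: "rootcdf d (root_poly A) x = real (count_le A x) / real d"
proof -
  have "(\<Sum>a\<in>{a. poly (root_poly A) a = 0 \<and> a \<le> x}. order a (root_poly A))
      = (\<Sum>a\<in>set_mset {#a \<in># A. a \<le> x#}. count {#a \<in># A. a \<le> x#} a)"
    using count_proots[OF root_poly_nonzero, of A]
    by (intro sum.cong) (auto simp: poly_root_poly_eq_0_iff proots_root_poly simp del: poly_prod_mset)
  also have "\<dots> = count_le A x"
    by (simp add: count_le_def size_multiset_overloaded_eq)
  finally show ?thesis by (simp add: rootcdf_def)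
qed

theorem mainTheorem8:
  fixes d :: nat and p1 p2 r :: "real poly"
  assumes "p1 \<in> Pd d UNIV" and "p2 \<in> Pd d UNIV" and "r \<in> Pd d {0..}"
  shows "dK d (mconv d p1 r) (mconv d p2 r) \<le> dK d p1 p2"
proof -
  obtain A B R where p1: "p1 = root_poly A" "size A = d" and p2: "p2 = root_poly B" "size B = d"
    and r: "r = root_poly R" "size R = d" and "set_mset R \<subseteq> {0..}"
    using assms by (auto simp: Pd_def)
  then have R: "\<rho> \<ge> 0" if "\<rho> \<in># R" for \<rho> using that by auto
  have m1: "mconv d p1 r = root_poly (mconv_roots R A)"
    using mconv_eq_root_poly[of A R] p1 r R by simp
  have m2: "mconv d p2 r = root_poly (mconv_roots R B)"
    using mconv_eq_root_poly[of B R] p2 r R by simp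
  \<comment> \<open>Every bound admissible for \<open>p1\<close> and \<open>p2\<close> is admissible
    for the convolutions, so the infima compare by inclusion of sets.\<close>
  have bound: "\<bar>rootcdf d (root_poly (mconv_roots R A)) x - rootcdf d (root_poly (mconv_roots R B)) x\<bar> \<le> e"
    if "e > 0" and e: "\<And>x. \<bar>rootcdf d (root_poly A) x - rootcdf d (root_poly B) x\<bar> \<le> e" for e x
  proof (cases "d = 0")
    \<comment> \<open>Division by zero makes both distribution functions 0.\<close>
    case True
    then show ?thesis using \<open>e > 0\<close> by (simp add: rootcdf_def)
  next
    case False
    \<comment> \<open>The counts are integers, so a difference of at most \<open>d * e\<close> is at
      most its floor.\<close>
    define k where "k = nat \<lfloor>real d * e\<rfloor>"
    have "\<bar>real (count_le A y) - real (count_le B y)\<bar> \<le> real d * e" for y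
      using e[of y] False unfolding rootcdf_root_poly
      by (simp add: field_simps flip: diff_divide_distrib)
    then have "\<bar>int (count_le A y) - int (count_le B y)\<bar> \<le> \<lfloor>real d * e\<rfloor>" for y
      by (simp add: le_floor_iff)
    moreover have "int k = \<lfloor>real d * e\<rfloor>" using \<open>e > 0\<close> by (simp add: k_def)
    ultimately have k: "\<bar>int (count_le A y) - int (count_le B y)\<bar> \<le> int k" for y by simp
    have "count_le (mconv_roots R A) x \<le> count_le (mconv_roots R B) x + k"
    proof (rule count_le_mconv_roots_shift)
      show "count_le A y \<le> count_le B y + k" for y using k[of y] by linarith
    qed (use p1 p2 r R in auto)
    moreover have "count_le (mconv_roots R B) x \<le> count_le (mconv_roots R A) x + k"
    proof (rule count_le_mconv_roots_shift)
      show "count_le B y \<le> count_le A y + k" for y using k[of y] by linarith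
    qed (use p1 p2 r R in auto)
    ultimately have "\<bar>real (count_le (mconv_roots R A) x) - real (count_le (mconv_roots R B) x)\<bar> \<le> real k"
      by linarith
    also have "\<dots> \<le> real d * e" using \<open>e > 0\<close> by (simp add: k_def)
    finally show ?thesis
      unfolding rootcdf_root_poly using False by (simp add: field_simps flip: diff_divide_distrib)
  qed
  \<comment> \<open>Comparing the infima requires an admissible bound for \<open>p1\<close> and
    \<open>p2\<close>; 1 always is one.\<close>
  have "\<bar>rootcdf d (root_poly A) x - rootcdf d (root_poly B) x\<bar> \<le> 1" for x
    using count_le_le_size[of A x] count_le_le_size[of B x] p1(2) p2(2)
    unfolding rootcdf_root_poly by (cases "d = 0") (auto simp: abs_le_iff field_simps)
  then have "{e. e > 0 \<and> (\<forall>x. \<bar>rootcdf d p1 x - rootcdf d p2 x\<bar> \<le> e)} \<noteq> {}"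
    by (auto simp: p1(1) p2(1) intro!: exI[of _ 1])
  then show ?thesis
    unfolding dK_def m1 m2 using bound
    by (intro cInf_superset_mono) (auto simp: p1(1) p2(1) intro!: bdd_belowI[of _ 0])
qed

end
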